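(* As $n\to\infty$, $$I_n=B_{n,1}\left(1+O\left(\exp\left(-\frac{(\log n)^2}{3}\right)\right)\right).$$
   Context: A partition of a set of $n$ elements into nonempty blocks of sizes $a_1,\ldots,a_l$ is called practical if $\{\sum_{i=1}^l\varepsilon_i a_i:\varepsilon_i\in\{0,1\}\}=\{0,1,\ldots,n\}$, i.e. its blocks can be combined to form subsets of every size between $1$ and $n$. $P_n$ is the number of practical partitions of an $n$-element set, $B_n$ the $n$-th Bell number (total number of partitions), and $I_n=B_n-P_n$ the number of non-practical (impractical) partitions. $B_{n,1}$ is the number of partitions of an $n$-element set having no block of size $1$. *)

theory Defs
  imports Complex_Main "HOL-Library.Disjoint_Sets" "HOL-Library.Landau_Symbols"
begin

text \<open>A choice of coefficients \<open>\<epsilon>\<^sub>i \<in> {0, 1}\<close> is the set \<open>S \<subseteq> P\<close> of the blocks with coefficient 1,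
  so blocks of equal size are counted separately.\<close>

definition practical_partition :: "'a set \<Rightarrow> 'a set set \<Rightarrow> bool" where
  "practical_partition A P \<longleftrightarrow>
     partition_on A P \<and> {\<Sum>b\<in>S. card b | S. S \<subseteq> P} = {0..card A}"

definition bell_number :: "nat \<Rightarrow> nat" where
  "bell_number n = card {P. partition_on {1..n} P}"

definition practical_number :: "nat \<Rightarrow> nat" where
  "practical_number n = card {P. practical_partition {1..n} P}"

definition impractical_number :: "nat \<Rightarrow> nat" where
  "impractical_number n = bell_number n - practical_number n"

definition singleton_free_number :: "nat \<Rightarrow> nat" where
  "singleton_free_number n = card {P. partition_on {1..n} P \<and> (\<forall>b\<in>P. card b \<noteq> 1)}"

text \<open>The subtraction in \<open>impractical_number\<close> never truncates.\<close>

lemma practical_number_le_bell_number: "practical_number n \<le> bell_number n"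
  unfolding practical_number_def bell_number_def practical_partition_def
  by (intro card_mono finitely_many_partition_on) auto

lemma impractical_number_eq_card:
  "impractical_number n = card {P. partition_on {1..n} P \<and> \<not> practical_partition {1..n} P}"
proof -
  have "{P. partition_on {1..n} P \<and> \<not> practical_partition {1..n} P} =
        {P. partition_on {1..n} P} - {P. practical_partition {1..n} P}"
    by auto
  moreover have "{P. practical_partition {1..n} P} \<subseteq> {P. partition_on {1..n} P}"
    by (auto simp: practical_partition_def)
  moreover have "finite {P. partition_on {1..n} P}"
    by (intro finitely_many_partition_on) auto
  ultimately show ?thesis
    by (simp add: card_Diff_subset finite_subset impractical_number_def bell_number_def
        practical_number_def)
qed

end

theory Submission
  imports Defs "HOL-Real_Asymp.Real_Asymp"
begin

text \<open>
  An impractical partition with a singleton has a gap: for some \<open>s \<ge> 1\<close> its blocks of size at most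
  \<open>s + 1\<close> have total size exactly \<open>s\<close>. Splitting off these blocks bounds the number of such partitions
  of an \<open>n\<close>-set by the sum over \<open>s\<close> of \<open>n!\<close> times the coefficient of \<open>X^(n - s)\<close> in
  \<open>exp (\<Sum>j>s+1. X^j / j!)\<close>, and a coefficient of a series with nonnegative coefficients is at most
  its value at \<open>x\<close> divided by a power of \<open>x\<close>.
  Conversely, the number of partitions without singletons is at least the number of all partitions
  of an \<open>(n - 2)\<close>-set, hence at least \<open>k^(n - 2) / k!\<close> for every \<open>k\<close>.
  Choosing \<open>k\<close> with \<open>k ln k \<approx> n\<close> and \<open>x = ln k\<close>, both bounds agree up to a power of \<open>n\<close>, except that
  the absence of blocks of size 2 contributes a factor \<open>exp (- x^2 / 2)\<close> to the first;
  for \<open>s > x^3\<close> evaluation at \<open>x^3 / 4\<close> gives an exponentially small ratio.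
\<close>

section \<open>Partitions into large blocks\<close>

lemma partition_on_subset:
  assumes "partition_on A P" "Q \<subseteq> P"
  shows "partition_on (\<Union>Q) Q"
  using assms by (auto simp: partition_on_def disjoint_def)

lemma partition_on_Diff:
  assumes "partition_on A P" "Q \<subseteq> P"
  shows "partition_on (A - \<Union>Q) (P - Q)"
proof -
  have "b \<inter> c = {}" if "b \<in> P - Q" "c \<in> Q" for b c
    using that assms partition_onD2[OF assms(1)] by (auto dest!: disjointD[of P b c])
  then have "\<Union>(P - Q) = A - \<Union>Q"
    using partition_onD1[OF assms(1)] assms(2) by auto
  then show ?thesis
    using partition_on_subset[OF assms(1), of "P - Q"] by auto
qed

lemma sum_over_large_subsets:
  fixes g :: "nat \<Rightarrow> 'b::comm_semiring_1"
  assumes "finite A"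
  shows "(\<Sum>C | C \<subseteq> A \<and> t \<le> card C. g (card C)) = (\<Sum>c=t..card A. of_nat (card A choose c) * g c)"
proof -
  have fin: "finite {C. C \<subseteq> A \<and> t \<le> card C}"
    using assms by simp
  have "(\<Sum>C | C \<subseteq> A \<and> t \<le> card C. g (card C)) =
      (\<Sum>c=t..card A. \<Sum>C | C \<in> {C. C \<subseteq> A \<and> t \<le> card C} \<and> card C = c. g (card C))"
    using fin assms by (intro sum.group[symmetric]) (auto intro: card_mono)
  also have "\<dots> = (\<Sum>c=t..card A. of_nat (card A choose c) * g c)"
  proof (intro sum.cong refl)
    fix c assume "c \<in> {t..card A}"
    then have "{C. C \<in> {C. C \<subseteq> A \<and> t \<le> card C} \<and> card C = c} = {C. C \<subseteq> A \<and> card C = c}"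
      by auto
    then show "(\<Sum>C | C \<in> {C. C \<subseteq> A \<and> t \<le> card C} \<and> card C = c. g (card C))
        = of_nat (card A choose c) * g c"
      using n_subsets[OF assms, of c] by simp
  qed
  finally show ?thesis .
qed

text \<open>The bound is strict so that, on finite sets, \<open>t = 0\<close> gives all partitions,
  \<open>t = 1\<close> the singleton-free ones, and \<open>t = Suc s\<close> the part above a gap at
  \<open>s\<close>.\<close>

definition large_block_partitions :: "nat \<Rightarrow> 'a set \<Rightarrow> 'a set set set" where
  "large_block_partitions t A = {P. partition_on A P \<and> (\<forall>b\<in>P. t < card b)}"

lemma finite_large_block_partitions:
  "finite A \<Longrightarrow> finite (large_block_partitions t A)"
  unfolding large_block_partitions_def
  by (rule finite_subset[OF _ finitely_many_partition_on[of A]]) auto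

lemma large_block_partitions_empty: "large_block_partitions t {} = {{}}"
  by (auto simp: large_block_partitions_def partition_on_empty)

lemma large_block_partitions_0:
  assumes "finite A"
  shows "large_block_partitions 0 A = {P. partition_on A P}"
proof -
  have "card b > 0" if "partition_on A P" "b \<in> P" for P b
    using that assms by (metis card_gt_0_iff partition_onD1 partition_onD3
        Union_upper finite_subset)
  then show ?thesis by (auto simp: large_block_partitions_def)
qed

text \<open>Classify the partitions by the block \<open>insert a C\<close> of \<open>a\<close>.
  Since \<open>a\<close> itself counts, this block has more than \<open>t\<close> elements exactly
  when \<open>C\<close> has at least \<open>t\<close>; the other blocks partition
  \<open>A - C\<close>.\<close>

lemma card_large_block_partitions_insert:
  assumes "finite A" "a \<notin> A"
  shows "card (large_block_partitions t (insert a A)) =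
    (\<Sum>C | C \<subseteq> A \<and> t \<le> card C. card (large_block_partitions t (A - C)))"
proof -
  let ?S = "SIGMA C:{C. C \<subseteq> A \<and> t \<le> card C}. large_block_partitions t (A - C)"
  let ?f = "\<lambda>(C, Q). insert (insert a C) Q"
  have inj: "inj_on ?f ?S"
  proof (rule inj_onI, clarify)
    fix C Q C' Q'
    assume C: "C \<subseteq> A" "Q \<in> large_block_partitions t (A - C)"
      and C': "C' \<subseteq> A" "Q' \<in> large_block_partitions t (A - C')"
      and eq: "insert (insert a C) Q = insert (insert a C') Q'"
    have "\<Union>Q = A - C" "\<Union>Q' = A - C'"
      using C C' by (auto simp: large_block_partitions_def partition_on_def)
    then have notin: "\<And>b. b \<in> Q \<union> Q' \<Longrightarrow> a \<notin> b"
      using assms by auto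
    then have "insert a C = insert a C'" using eq by (metis insertE insertI1 UnI1 UnI2)
    then have CC: "C = C'" using C C' assms by auto
    have "Q = insert (insert a C) Q - {insert a C}" "Q' = insert (insert a C') Q' - {insert a C'}"
      using notin by blast+
    then show "C = C' \<and> Q = Q'" using CC eq by metis
  qed
  have img: "?f ` ?S = large_block_partitions t (insert a A)"
  proof (intro equalityI subsetI)
    fix P assume "P \<in> ?f ` ?S"
    then obtain C Q where C: "C \<subseteq> A" "t \<le> card C" "Q \<in> large_block_partitions t (A - C)"
      and P: "P = insert (insert a C) Q" by auto
    have Q: "\<Union>Q = A - C" "partition_on (A - C) Q"
      using C by (auto simp: large_block_partitions_def partition_on_def)
    have disj: "disjnt (insert a C) (\<Union>Q)" using Q assms by (auto simp: disjnt_def)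
    have "insert a A - insert a C = A - C" using assms C by auto
    then have "partition_on (insert a A) P"
      unfolding P partition_on_insert[OF disj] using Q C by auto
    moreover have "t < card (insert a C)"
      using C assms finite_subset[OF C(1)] by (subst card_insert_disjoint) auto
    ultimately show "P \<in> large_block_partitions t (insert a A)"
      using C by (auto simp: large_block_partitions_def P)
  next
    fix P assume P: "P \<in> large_block_partitions t (insert a A)"
    then have part: "partition_on (insert a A) P"
      by (simp add: large_block_partitions_def)
    then obtain b where b: "b \<in> P" "a \<in> b" by (auto simp: partition_on_def)
    have sub: "b \<subseteq> insert a A" using part b by (auto simp: partition_on_def)
    have disj: "disjnt b (\<Union>(P - {b}))"
      using part b by (auto simp: partition_on_def disjoint_def disjnt_def)
    have "partition_on (insert a A - b) (P - {b})"
      using partition_on_insert[OF disj, of "insert a A"] part b by (simp add: insert_absorb)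
    moreover have "insert a A - b = A - (b - {a})" using b assms by auto
    ultimately have "P - {b} \<in> large_block_partitions t (A - (b - {a}))"
      using P by (auto simp: large_block_partitions_def)
    moreover have "t < card b" using P b by (auto simp: large_block_partitions_def)
    moreover have "finite b" using sub assms finite_subset by blast
    ultimately have S: "(b - {a}, P - {b}) \<in> ?S" using sub b by auto
    show "P \<in> ?f ` ?S"
      by (rule rev_image_eqI[OF S]) (use b in \<open>simp add: insert_absorb\<close>)
  qed
  have "card (large_block_partitions t (insert a A)) = card ?S"
    using card_image[OF inj] unfolding img .
  also have "\<dots> = (\<Sum>C | C \<subseteq> A \<and> t \<le> card C. card (large_block_partitions t (A - C)))"
    using assms by (subst card_SigmaI) (auto intro: finite_large_block_partitions)
  finally show ?thesis .
qed

section \<open>The generating function bound\<close>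

text \<open>The coefficient of \<open>X^m\<close> in the series \<open>F = exp G\<close> with
  \<open>G = (\<Sum>j>t. X^j / j!)\<close>; the recurrence compares coefficients in
  \<open>F' = G' F\<close>.\<close>

fun egf_coeff :: "nat \<Rightarrow> nat \<Rightarrow> real" where
  "egf_coeff t 0 = 1"
| "egf_coeff t (Suc m) = (\<Sum>c=t..m. egf_coeff t (m - c) / fact c) / real (Suc m)"

declare egf_coeff.simps(2) [simp del]

lemma egf_coeff_nonneg: "egf_coeff t m \<ge> 0"
proof (induction m rule: less_induct)
  case (less m)
  then show ?case by (cases m) (auto simp: egf_coeff.simps(2) intro!: sum_nonneg divide_nonneg_nonneg)
qed

text \<open>The recurrence divides a sum of at most \<open>Suc m\<close> terms, each at most 1, by
  \<open>Suc m\<close>. For \<open>t = 0\<close> this will bound the number of partitions of an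
  \<open>s\<close>-set by \<open>s!\<close>.\<close>

lemma egf_coeff_le_1: "egf_coeff t m \<le> 1"
proof (induction m rule: less_induct)
  case (less m)
  show ?case
  proof (cases m)
    case (Suc k)
    have "(\<Sum>c=t..k. egf_coeff t (k - c) / fact c) \<le> (\<Sum>c=t..k. 1)"
    proof (rule sum_mono)
      fix c
      have "egf_coeff t (k - c) \<le> 1" using less[of "k - c"] Suc by simp
      also have "1 \<le> (fact c :: real)" by (rule fact_ge_1)
      finally show "egf_coeff t (k - c) / fact c \<le> 1" by simp
    qed
    also have "\<dots> \<le> real (Suc k)" by simp
    finally show ?thesis unfolding Suc egf_coeff.simps(2) by (simp add: divide_le_eq)
  qed simp
qed

text \<open>Divided by factorials, the recurrence on the block of a fixed element becomes that of
  \<open>egf_coeff\<close>: the binomial coefficient times \<open>fact (?m - c)\<close> is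
  \<open>fact ?m / fact c\<close>.\<close>

lemma card_large_block_partitions_le_egf_coeff:
  assumes "finite A"
  shows "real (card (large_block_partitions t A)) \<le> fact (card A) * egf_coeff t (card A)"
  using assms
proof (induction "card A" arbitrary: A rule: less_induct)
  case less
  show ?case
  proof (cases "A = {}")
    case True
    then show ?thesis by (simp add: large_block_partitions_empty)
  next
    case False
    then obtain a B where A: "A = insert a B" "a \<notin> B" by (meson Set.set_insert ex_in_conv)
    then have B: "finite B" "card A = Suc (card B)" using less.prems by auto
    let ?m = "card B"
    have "real (card (large_block_partitions t A))
        = (\<Sum>C | C \<subseteq> B \<and> t \<le> card C. real (card (large_block_partitions t (B - C))))"
      unfolding A using card_large_block_partitions_insert[OF B(1) A(2)] by simp
    also have "\<dots> \<le> (\<Sum>C | C \<subseteq> B \<and> t \<le> card C. fact (?m - card C) * egf_coeff t (?m - card C))"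
    proof (rule sum_mono)
      fix C assume "C \<in> {C. C \<subseteq> B \<and> t \<le> card C}"
      then have "C \<subseteq> B" by simp
      then have "card (B - C) = ?m - card C" using B finite_subset card_Diff_subset by metis
      then show "real (card (large_block_partitions t (B - C)))
          \<le> fact (?m - card C) * egf_coeff t (?m - card C)"
        using less.hyps[of "B - C"] B by simp
    qed
    also have "\<dots> = (\<Sum>c=t..?m. real (?m choose c) * (fact (?m - c) * egf_coeff t (?m - c)))"
      by (rule sum_over_large_subsets[OF B(1)])
    also have "\<dots> = (\<Sum>c=t..?m. fact ?m * (egf_coeff t (?m - c) / fact c))"
      by (intro sum.cong refl) (simp add: binomial_fact field_simps)
    also have "\<dots> = fact (card A) * egf_coeff t (card A)"
      unfolding B(2) egf_coeff.simps(2) by (simp add: sum_distrib_left field_simps)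
    finally show ?thesis .
  qed
qed

text \<open>The differential inequality \<open>p' \<le> G' p\<close> for the truncated generating function \<open>p\<close>
  makes \<open>p exp (-G)\<close> decreasing.\<close>

lemma egf_coeff_power_le:
  assumes "x \<ge> 0" "m \<le> N"
  shows "egf_coeff t m * x ^ m \<le> exp (\<Sum>j=Suc t..N. x ^ j / fact j)"
proof -
  define p where "p = (\<lambda>y::real. \<Sum>m\<le>N. egf_coeff t m * y ^ m)"
  define p' where "p' = (\<lambda>y::real. \<Sum>m<N. (\<Sum>c=t..m. egf_coeff t (m - c) / fact c) * y ^ m)"
  define G where "G = (\<lambda>y::real. \<Sum>j=Suc t..N. y ^ j / fact j)"
  define G' where "G' = (\<lambda>y::real. \<Sum>j=Suc t..N. y ^ (j - 1) / fact (j - 1))"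
  have G'_deriv: "(G has_real_derivative G' y) (at y)" for y
  proof -
    have "real j / fact j = 1 / fact (j - 1)" if "j \<in> {Suc t..N}" for j
      using that by (cases j) (auto simp: fact_Suc simp del: of_nat_Suc)
    then show ?thesis unfolding G_def G'_def
      by (auto intro!: derivative_eq_intros sum.cong simp: field_simps)
  qed
  have p'_deriv: "(p has_real_derivative p' y) (at y)" for y
  proof -
    have "(p has_real_derivative (\<Sum>m\<le>N. egf_coeff t m * (real m * y ^ (m - 1)))) (at y)"
      unfolding p_def by (auto intro!: derivative_eq_intros sum.cong)
    also have "(\<Sum>m\<le>N. egf_coeff t m * (real m * y ^ (m - 1))) =
        (\<Sum>m<N. egf_coeff t (Suc m) * (real (Suc m) * y ^ m))"
      by (simp add: sum.atMost_shift)
    also have "\<dots> = p' y" unfolding p'_def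
      by (intro sum.cong refl) (simp add: egf_coeff.simps(2) del: of_nat_Suc)
    finally show ?thesis .
  qed
  \<comment> \<open>The substitution \<open>(m, c) \<mapsto> (Suc c, m - c)\<close> sends the terms
    of \<open>p'\<close> injectively to terms of the product; the product terms not reached are
    nonnegative for \<open>y \<ge> 0\<close>.\<close>
  have ineq: "p' y \<le> G' y * p y" if "y \<ge> 0" for y
  proof -
    have "p' y = (\<Sum>m<N. \<Sum>c=t..m. egf_coeff t (m - c) * y ^ (m - c) * (y ^ c / fact c))"
      unfolding p'_def sum_distrib_right
      by (intro sum.cong refl) (simp add: power_add[symmetric])
    also have "\<dots> = (\<Sum>(m, c)\<in>(SIGMA m:{..<N}. {t..m}). egf_coeff t (m - c) * y ^ (m - c) * (y ^ c / fact c))"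
      by (simp add: sum.Sigma)
    also have "\<dots> = (\<Sum>(j, i)\<in>(\<lambda>(m, c). (Suc c, m - c)) ` (SIGMA m:{..<N}. {t..m}).
        y ^ (j - 1) / fact (j - 1) * (egf_coeff t i * y ^ i))"
      by (subst sum.reindex) (auto simp: inj_on_def intro!: sum.cong)
    also have "\<dots> \<le> (\<Sum>(j, i)\<in>{Suc t..N} \<times> {..N}.
        y ^ (j - 1) / fact (j - 1) * (egf_coeff t i * y ^ i))"
      using that by (intro sum_mono2) (auto intro!: mult_nonneg_nonneg divide_nonneg_nonneg egf_coeff_nonneg)
    also have "\<dots> = G' y * p y"
      unfolding G'_def p_def by (simp add: sum_product sum.cartesian_product)
    finally show ?thesis .
  qed
  have "p x * exp (- G x) \<le> p 0 * exp (- G 0)"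
  proof (rule DERIV_nonpos_imp_nonincreasing[OF assms(1)])
    fix y :: real assume y: "0 \<le> y" "y \<le> x"
    have "((\<lambda>y. p y * exp (- G y)) has_real_derivative (p' y - G' y * p y) * exp (- G y)) (at y)"
      by (auto intro!: derivative_eq_intros p'_deriv G'_deriv simp: algebra_simps)
    moreover have "(p' y - G' y * p y) * exp (- G y) \<le> 0"
      using ineq[OF y(1)] by (intro mult_nonpos_nonneg) auto
    ultimately show "\<exists>z. ((\<lambda>y. p y * exp (- G y)) has_real_derivative z) (at y) \<and> z \<le> 0"
      by blast
  qed
  moreover have "p 0 = 1"
    unfolding p_def by (simp add: sum.atMost_shift)
  moreover have "G 0 = 0"
    unfolding G_def by (intro sum.neutral) auto
  ultimately have "p x \<le> exp (G x)"
    by (simp add: exp_minus field_simps)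
  moreover have "egf_coeff t m * x ^ m \<le> p x"
    unfolding p_def using assms
    by (intro member_le_sum) (auto intro!: mult_nonneg_nonneg egf_coeff_nonneg)
  ultimately show ?thesis unfolding G_def by simp
qed

section \<open>Lower bound for partitions without singletons\<close>

text \<open>There are \<open>k ^ card A\<close> colourings of \<open>A\<close> with \<open>k\<close>
  colours, and each partition is the partition into colour classes of at most \<open>k!\<close> of
  them. The induction removes the colour class of one element.\<close>

lemma power_le_fact_mult_card_partitions:
  assumes "finite A"
  shows "k ^ card A \<le> fact k * card (large_block_partitions 0 A)"
  using assms
proof (induction "card A" arbitrary: A k rule: less_induct)
  case less
  show ?case
  proof (cases "A = {} \<or> k = 0")
    case True
    then show ?thesis
      using less.prems
      by (cases "A = {}") (simp_all add: large_block_partitions_empty power_0_left)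
  next
    case False
    then obtain a B l where A: "A = insert a B" "a \<notin> B" and k: "k = Suc l"
      by (metis Set.set_insert ex_in_conv not0_implies_Suc)
    then have B: "finite B" "card A = Suc (card B)" using less.prems by auto
    let ?m = "card B"
    \<comment> \<open>With the colour of \<open>a\<close> fixed, \<open>c\<close> counts the
      elements of \<open>B\<close> sharing it; the others use the \<open>l\<close> remaining
      colours. The factor \<open>k\<close> for the colour of \<open>a\<close> is restored at the
      end.\<close>
    have "k ^ ?m = (\<Sum>c=0..?m. (?m choose c) * l ^ (?m - c))"
      unfolding k using binomial[of 1 l ?m] by (simp add: atMost_atLeast0)
    also have "\<dots> = (\<Sum>C | C \<subseteq> B \<and> 0 \<le> card C. l ^ (?m - card C))"
      using sum_over_large_subsets[OF B(1), of "\<lambda>c. l ^ (?m - c)" 0] by simp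
    also have "\<dots> \<le> (\<Sum>C | C \<subseteq> B \<and> 0 \<le> card C. fact l * card (large_block_partitions 0 (B - C)))"
    proof (rule sum_mono)
      fix C assume "C \<in> {C. C \<subseteq> B \<and> 0 \<le> card C}"
      then have "C \<subseteq> B" by simp
      then have "card (B - C) = ?m - card C" using B finite_subset card_Diff_subset by metis
      then show "l ^ (?m - card C) \<le> fact l * card (large_block_partitions 0 (B - C))"
        using less.hyps[of "B - C" l] B by simp
    qed
    also have "\<dots> = fact l * card (large_block_partitions 0 A)"
      unfolding A card_large_block_partitions_insert[OF B(1) A(2)] by (simp add: sum_distrib_left)
    finally have "k * k ^ ?m \<le> k * (fact l * card (large_block_partitions 0 A))"
      by (rule mult_le_mono2)
    then show ?thesis unfolding B(2) k by (simp add: algebra_simps)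
  qed
qed

text \<open>Collecting the singletons of a partition of \<open>A\<close> into one block together with two new
  elements yields a partition without singletons.\<close>

lemma card_partitions_le_card_singleton_free:
  assumes "finite A" "a \<notin> A" "b \<notin> A" "a \<noteq> b"
  shows "card (large_block_partitions 0 A) \<le> card (large_block_partitions 1 (insert a (insert b A)))"
proof -
  have "large_block_partitions 0 A \<subseteq>
      (\<Union>C\<in>Pow A. (\<lambda>Q. Q \<union> (\<lambda>x. {x}) ` C) ` large_block_partitions 1 (A - C))"
  proof
    fix P assume P: "P \<in> large_block_partitions 0 A"
    define S where "S = {p \<in> P. card p = 1}"
    define C where "C = \<Union>S"
    have part: "partition_on A P" using P by (simp add: large_block_partitions_def)
    have S: "S = (\<lambda>x. {x}) ` C"
    proof (intro equalityI subsetI)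
      fix p assume "p \<in> S"
      moreover from this obtain x where "p = {x}"
        by (auto simp: S_def card_1_singleton_iff)
      ultimately show "p \<in> (\<lambda>x. {x}) ` C" by (auto simp: C_def)
    next
      fix p assume "p \<in> (\<lambda>x. {x}) ` C"
      then obtain x q where "p = {x}" "q \<in> S" "x \<in> q" by (auto simp: C_def)
      moreover from this obtain y where "q = {y}"
        by (auto simp: S_def card_1_singleton_iff)
      ultimately show "p \<in> S" by simp
    qed
    have "partition_on (A - C) (P - S)"
      unfolding C_def by (rule partition_on_Diff[OF part]) (auto simp: S_def)
    moreover have "1 < card p" if "p \<in> P - S" for p
      using that P by (force simp: large_block_partitions_def S_def)
    ultimately have "P - S \<in> large_block_partitions 1 (A - C)"
      by (simp add: large_block_partitions_def)
    moreover have "P = (P - S) \<union> (\<lambda>x. {x}) ` C"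
      unfolding S[symmetric] S_def by auto
    moreover have "C \<in> Pow A"
      unfolding C_def S_def using partition_onD1[OF part] by auto
    ultimately show "P \<in> (\<Union>C\<in>Pow A. (\<lambda>Q. Q \<union> (\<lambda>x. {x}) ` C) ` large_block_partitions 1 (A - C))"
      by blast
  qed
  then have "card (large_block_partitions 0 A) \<le>
      card (\<Union>C\<in>Pow A. (\<lambda>Q. Q \<union> (\<lambda>x. {x}) ` C) ` large_block_partitions 1 (A - C))"
    using assms(1) by (intro card_mono) (auto intro!: finite_large_block_partitions)
  also have "\<dots> \<le> (\<Sum>C\<in>Pow A. card ((\<lambda>Q. Q \<union> (\<lambda>x. {x}) ` C) ` large_block_partitions 1 (A - C)))"
    using assms(1) by (intro card_UN_le) simp
  also have "\<dots> \<le> (\<Sum>C\<in>Pow A. card (large_block_partitions 1 (A - C)))"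
    using assms(1) by (intro sum_mono card_image_le finite_large_block_partitions) simp
  \<comment> \<open>Adding \<open>b\<close> on both sides makes this the part of the recurrence at
    \<open>a\<close> in which the block of \<open>a\<close> contains \<open>b\<close>; such a block
    has at least two elements even if \<open>C\<close> is empty.\<close>
  also have "\<dots> = (\<Sum>C\<in>Pow A. card (large_block_partitions 1 (insert b A - insert b C)))"
    using assms by (intro sum.cong refl arg_cong[where f = card] arg_cong[where f = "large_block_partitions 1"]) auto
  also have "\<dots> = (\<Sum>C\<in>insert b ` Pow A. card (large_block_partitions 1 (insert b A - C)))"
    using assms by (subst sum.reindex) (auto simp: inj_on_def)
  also have "\<dots> \<le> (\<Sum>C | C \<subseteq> insert b A \<and> 1 \<le> card C. card (large_block_partitions 1 (insert b A - C)))"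
    using assms(1)
    by (intro sum_mono2) (auto simp: Suc_le_eq card_gt_0_iff intro: finite_subset)
  also have "\<dots> = card (large_block_partitions 1 (insert a (insert b A)))"
    using assms by (intro card_large_block_partitions_insert[symmetric]) auto
  finally show ?thesis .
qed

section \<open>Gaps of impractical partitions\<close>

text \<open>Add the elements in order of increasing weight. If the sums so far fill an initial
  segment, a new weight at most one above its end shifts that segment without leaving a
  hole.\<close>

lemma subset_sums_complete:
  fixes f :: "'a \<Rightarrow> nat"
  assumes "finite P" "\<And>b. b \<in> P \<Longrightarrow> f b \<le> Suc (\<Sum>c | c \<in> P \<and> f c < f b. f c)" "v \<le> sum f P"
  shows "\<exists>S\<subseteq>P. sum f S = v"
  using assms
proof (induction P arbitrary: v rule: finite_ranking_induct[where f = f])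
  case empty
  then show ?case by simp
next
  case (insert b P)
  show ?case
  proof (cases "b \<in> P")
    case True
    then show ?thesis using insert by (simp add: insert_absorb)
  next
    case False
    \<comment> \<open>The induction inserts an element \<open>b\<close> of largest weight, so it
      never occurs among strictly lighter elements and the hypothesis passes to
      \<open>P\<close>.\<close>
    have eq: "{c. c \<in> insert b P \<and> f c < f d} = {c. c \<in> P \<and> f c < f d}" if "d \<in> insert b P" for d
      using that insert.hyps(2) by force
    have IH: "\<exists>S\<subseteq>P. sum f S = v" if "v \<le> sum f P" for v
    proof (rule insert.IH[OF _ that])
      fix d assume "d \<in> P"
      then show "f d \<le> Suc (\<Sum>c | c \<in> P \<and> f c < f d. f c)"
        using insert.prems(1)[of d] eq[of d] by simp
    qed
    show ?thesis
    proof (cases "v \<le> sum f P")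
      case True
      then show ?thesis using IH by blast
    next
      case v: False
      have "f b \<le> Suc (\<Sum>c | c \<in> P \<and> f c < f b. f c)"
        using insert.prems(1)[of b] eq[of b] by simp
      also have "(\<Sum>c | c \<in> P \<and> f c < f b. f c) \<le> sum f P"
        using insert.hyps by (intro sum_mono2) auto
      finally have "f b \<le> v" using v by simp
      moreover have "v \<le> f b + sum f P"
        using insert.prems(2) insert.hyps(1) False by simp
      ultimately obtain S where S: "S \<subseteq> P" "sum f S = v - f b"
        using IH[of "v - f b"] by (auto simp: le_diff_conv)
      have "sum f (insert b S) = v"
        using S False insert.hyps(1) \<open>f b \<le> v\<close> by (subst sum.insert) (auto intro: finite_subset)
      then show ?thesis using S by (intro exI[of _ "insert b S"]) auto
    qed
  qed
qed

text \<open>Some block \<open>b\<close> exceeds the total size \<open>s\<close> of the strictly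
  smaller blocks by at least 2. Together with those blocks it occupies at least
  \<open>s + (s + 2)\<close> elements. The singleton is smaller than \<open>b\<close> and forces
  \<open>s \<ge> 1\<close>; a gap at \<open>s = 0\<close> would mean that there are no
  singletons.\<close>

lemma impractical_partition_gap:
  assumes "finite A" "partition_on A P" "\<not> practical_partition A P" "{a} \<in> P"
  obtains s where "1 \<le> s" "2 * s + 2 \<le> card A" "(\<Sum>c | c \<in> P \<and> card c \<le> Suc s. card c) = s"
proof -
  have fin: "finite P" using finite_elements assms by blast
  have finb: "finite b" if "b \<in> P" for b
    using that assms(1,2) by (metis Union_upper finite_subset partition_onD1)
  have card: "card A = sum card P"
    using product_partition[OF assms(2)] finb by blast
  have "\<exists>b\<in>P. \<not> card b \<le> Suc (\<Sum>c | c \<in> P \<and> card c < card b. card c)"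
  proof (rule ccontr)
    assume "\<not> ?thesis"
    then have "\<exists>S\<subseteq>P. sum card S = v" if "v \<le> card A" for v
      using subset_sums_complete[OF fin, of card v] that card by auto
    moreover have "sum card S \<le> card A" if "S \<subseteq> P" for S
      unfolding card using fin that by (intro sum_mono2) auto
    ultimately have "practical_partition A P"
      using assms(2) unfolding practical_partition_def by auto (metis (lifting))
    then show False using assms by simp
  qed
  then obtain b where b: "b \<in> P" "card b > Suc (\<Sum>c | c \<in> P \<and> card c < card b. card c)"
    by auto
  define s where "s = (\<Sum>c | c \<in> P \<and> card c < card b. card c)"
  \<comment> \<open>No block has size strictly between \<open>s\<close> and \<open>card b\<close>,
    so the threshold \<open>card b\<close> can be replaced by one depending on \<open>s\<close>
    alone.\<close>
  have "card c \<le> s" if "c \<in> P" "card c < card b" for c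
    unfolding s_def using fin that by (intro member_le_sum) auto
  then have "{c. c \<in> P \<and> card c \<le> Suc s} = {c. c \<in> P \<and> card c < card b}"
    using b unfolding s_def[symmetric] by force
  then have eq: "(\<Sum>c | c \<in> P \<and> card c \<le> Suc s. card c) = s"
    unfolding s_def by simp
  have "1 \<le> s"
    using member_le_sum[of "{a}" "{c. c \<in> P \<and> card c < card b}" card] assms(4) b fin
    unfolding s_def by auto
  moreover have "2 * s + 2 \<le> card A"
  proof -
    have "sum card (insert b {c. c \<in> P \<and> card c < card b}) \<le> card A"
      unfolding card using b fin by (intro sum_mono2) auto
    then show ?thesis using b fin unfolding s_def[symmetric] by (simp add: s_def)
  qed
  ultimately show thesis using that eq by blast
qed

text \<open>Choose the union \<open>U\<close> of the blocks below the gap, at most \<open>s!\<close>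
  partitions of it, and a partition of the rest into blocks larger than \<open>s + 1\<close>. The
  binomial coefficient for \<open>U\<close> turns \<open>s! (n - s)!\<close> into
  \<open>n!\<close>.\<close>

lemma card_impractical_with_singleton_le:
  assumes "finite A"
  shows "real (card {P. partition_on A P \<and> \<not> practical_partition A P \<and> (\<exists>b\<in>P. card b = 1)})
    \<le> (\<Sum>s | 1 \<le> s \<and> 2 * s + 2 \<le> card A. fact (card A) * egf_coeff (Suc s) (card A - s))"
proof -
  let ?I = "{s. 1 \<le> s \<and> 2 * s + 2 \<le> card A}"
  let ?X = "\<lambda>s U. (\<lambda>(Q, R). Q \<union> R) ` (large_block_partitions 0 U \<times> large_block_partitions (Suc s) (A - U))"
  let ?bad = "{P. partition_on A P \<and> \<not> practical_partition A P \<and> (\<exists>b\<in>P. card b = 1)}"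
  have finI: "finite ?I" by (rule finite_subset[of _ "{..card A}"]) auto
  have finX: "finite (?X s U)" if "U \<subseteq> A" for s U
    using that assms by (intro finite_imageI finite_cartesian_product finite_large_block_partitions)
      (auto intro: finite_subset)
  have "?bad \<subseteq> (\<Union>s\<in>?I. \<Union>U\<in>{U. U \<subseteq> A \<and> card U = s}. ?X s U)"
  proof
    fix P assume "P \<in> ?bad"
    then obtain b where P: "partition_on A P" "\<not> practical_partition A P" and b: "b \<in> P" "card b = 1"
      by blast
    obtain a where "b = {a}" using b(2) by (rule card_1_singletonE)
    obtain s where s: "1 \<le> s" "2 * s + 2 \<le> card A"
      and sum: "(\<Sum>c | c \<in> P \<and> card c \<le> Suc s. card c) = s"
      using impractical_partition_gap[OF assms P] b \<open>b = {a}\<close> by metis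
    define Q where "Q = {c. c \<in> P \<and> card c \<le> Suc s}"
    have Q: "partition_on (\<Union>Q) Q"
      using partition_on_subset[OF P(1)] by (simp add: Q_def)
    have sub: "\<Union>Q \<subseteq> A" using P(1) by (auto simp: Q_def partition_on_def)
    have finU: "finite (\<Union>Q)" using sub assms finite_subset by blast
    then have "card (\<Union>Q) = s"
      using product_partition[OF Q] sum by (simp add: Q_def[symmetric] finite_subset[OF Union_upper])
    moreover have "Q \<in> large_block_partitions 0 (\<Union>Q)"
      using Q large_block_partitions_0[OF finU] by simp
    moreover have "P - Q \<in> large_block_partitions (Suc s) (A - \<Union>Q)"
    proof -
      have "partition_on (A - \<Union>Q) (P - Q)"
        by (rule partition_on_Diff[OF P(1)]) (auto simp: Q_def)
      then show ?thesis by (auto simp: large_block_partitions_def Q_def)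
    qed
    moreover have "P = Q \<union> (P - Q)" by (auto simp: Q_def)
    ultimately have "\<Union>Q \<in> {U. U \<subseteq> A \<and> card U = s}" "P \<in> ?X s (\<Union>Q)"
      using sub by (auto intro!: image_eqI[of _ _ "(Q, P - Q)"])
    then show "P \<in> (\<Union>s\<in>?I. \<Union>U\<in>{U. U \<subseteq> A \<and> card U = s}. ?X s U)"
      using s by auto
  qed
  then have "card ?bad \<le> card (\<Union>s\<in>?I. \<Union>U\<in>{U. U \<subseteq> A \<and> card U = s}. ?X s U)"
    using finI finX assms by (intro card_mono) auto
  also have "\<dots> \<le> (\<Sum>s\<in>?I. card (\<Union>U\<in>{U. U \<subseteq> A \<and> card U = s}. ?X s U))"
    using finI by (rule card_UN_le)
  also have "\<dots> \<le> (\<Sum>s\<in>?I. \<Sum>U | U \<subseteq> A \<and> card U = s. card (?X s U))"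
    using assms by (intro sum_mono card_UN_le) auto
  finally have "real (card ?bad) \<le> (\<Sum>s\<in>?I. \<Sum>U | U \<subseteq> A \<and> card U = s. real (card (?X s U)))"
    by (simp flip: of_nat_sum)
  also have "\<dots> \<le> (\<Sum>s\<in>?I. \<Sum>U | U \<subseteq> A \<and> card U = s.
      fact s * (fact (card A - s) * egf_coeff (Suc s) (card A - s)))"
  proof (intro sum_mono)
    fix s U assume "U \<in> {U. U \<subseteq> A \<and> card U = s}"
    then have U: "U \<subseteq> A" "card U = s" by auto
    then have finU: "finite U" using assms finite_subset by blast
    have dif: "card (A - U) = card A - s" using U finU by (simp add: card_Diff_subset)
    have "card (?X s U) \<le> card (large_block_partitions 0 U \<times> large_block_partitions (Suc s) (A - U))"
      using finU assms by (intro card_image_le finite_cartesian_product finite_large_block_partitions) auto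
    then have "real (card (?X s U)) \<le>
        real (card (large_block_partitions 0 U)) * real (card (large_block_partitions (Suc s) (A - U)))"
      unfolding card_cartesian_product by (simp only: of_nat_mult[symmetric] of_nat_le_iff)
    also have "\<dots> \<le> (fact s * 1) * (fact (card A - s) * egf_coeff (Suc s) (card A - s))"
    proof (intro mult_mono)
      have "real (card (large_block_partitions 0 U)) \<le> fact s * egf_coeff 0 s"
        using card_large_block_partitions_le_egf_coeff[OF finU] U by simp
      also have "\<dots> \<le> fact s * 1" by (intro mult_left_mono egf_coeff_le_1) simp
      finally show "real (card (large_block_partitions 0 U)) \<le> fact s * 1" .
      show "real (card (large_block_partitions (Suc s) (A - U)))
          \<le> fact (card A - s) * egf_coeff (Suc s) (card A - s)"
        using card_large_block_partitions_le_egf_coeff[of "A - U" "Suc s"] assms dif by simp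
    qed auto
    finally show "real (card (?X s U)) \<le> fact s * (fact (card A - s) * egf_coeff (Suc s) (card A - s))"
      by simp
  qed
  also have "\<dots> = (\<Sum>s\<in>?I. fact (card A) * egf_coeff (Suc s) (card A - s))"
    by (intro sum.cong refl) (simp add: n_subsets[OF assms] binomial_fact)
  finally show ?thesis .
qed

section \<open>Asymptotic estimates\<close>

text \<open>A weak Stirling bound \<open>n! \<le> e n (n / e)^n\<close>; the induction step rests on
  \<open>1 - 1 / (n + 1) \<le> exp (- 1 / (n + 1))\<close>.\<close>

lemma fact_le_power_exp:
  assumes "n \<ge> 1"
  shows "fact n \<le> real n ^ Suc n * exp (1 - real n)"
  using assms
proof (induction n rule: nat_induct_at_least)
  case base
  then show ?case by simp
next
  case (Suc n)
  have "1 + (- 1 / real (Suc n)) \<le> exp (- 1 / real (Suc n))"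
    by (rule exp_ge_add_one_self)
  then have "real n / real (Suc n) \<le> exp (- 1 / real (Suc n))"
    by (simp add: field_simps)
  then have "(real n / real (Suc n)) ^ Suc n \<le> exp (- 1 / real (Suc n)) ^ Suc n"
    by (intro power_mono) auto
  also have "\<dots> = exp (- 1)"
    by (simp add: exp_of_nat_mult[symmetric] del: of_nat_Suc power_Suc)
  finally have "real n ^ Suc n \<le> exp (- 1) * real (Suc n) ^ Suc n"
    by (simp add: power_divide divide_le_eq del: of_nat_Suc power_Suc)
  then have le: "exp (1 - real n) * real n ^ Suc n \<le> exp (1 - real n) * (exp (- 1) * real (Suc n) ^ Suc n)"
    by (intro mult_left_mono) auto
  have "fact (Suc n) = real (Suc n) * fact n" by simp
  also have "\<dots> \<le> real (Suc n) * (real n ^ Suc n * exp (1 - real n))"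
    using Suc.IH by (intro mult_left_mono) auto
  also have "\<dots> \<le> real (Suc n) * (exp (1 - real n) * (exp (- 1) * real (Suc n) ^ Suc n))"
    using le by (intro mult_left_mono) (auto simp: mult.commute)
  also have "exp (1 - real n) * (exp (- 1) * real (Suc n) ^ Suc n) = real (Suc n) ^ Suc n * exp (1 - real (Suc n))"
    by (simp add: exp_add[symmetric] del: power_Suc)
  finally show ?case by simp
qed

lemma sum_power_div_fact_le_exp:
  fixes x :: real
  assumes "x \<ge> 0" "finite J"
  shows "(\<Sum>j\<in>J. x ^ j / fact j) \<le> exp x"
proof -
  have "(\<Sum>j\<in>J. x ^ j /\<^sub>R fact j) \<le> (\<Sum>j. x ^ j /\<^sub>R fact j)"
    using assms summable_exp_generic[of x] by (intro sum_le_suminf) auto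
  then show ?thesis by (simp add: exp_def divide_inverse mult.commute)
qed

text \<open>Using \<open>x ^ n\<close> instead of \<open>x ^ (n - s)\<close> costs
  \<open>x ^ s\<close>. Size 2 is always missing from the exponent, which saves
  \<open>x\<^sup>2 / 2\<close>. For \<open>s \<le> 2\<close> the cost is the factor
  \<open>x\<^sup>2\<close>; for \<open>s \<ge> 3\<close> size 4 is missing as well, and its term
  \<open>x ^ 4 / 24\<close> pays for \<open>x ^ s\<close>.\<close>

lemma egf_coeff_le_small_gap:
  fixes x :: real
  assumes "1 \<le> s" "s \<le> n" "1 \<le> x" "real s \<le> x ^ 3" "ln x \<le> x / 24"
  shows "egf_coeff (Suc s) (n - s) * x ^ n \<le> x\<^sup>2 * exp (exp x - x\<^sup>2 / 2)"
proof -
  let ?G = "\<Sum>j=Suc (Suc s)..n. x ^ j / fact j"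
  have main: "x ^ s * exp ?G \<le> x\<^sup>2 * exp (exp x - x\<^sup>2 / 2)"
  proof (cases "s \<le> 2")
    case True
    have "(\<Sum>j\<in>insert 2 {Suc (Suc s)..n}. x ^ j / fact j) \<le> exp x"
      using assms by (intro sum_power_div_fact_le_exp) auto
    then have "?G \<le> exp x - x\<^sup>2 / 2"
      using assms(1) by simp
    moreover have "x ^ s \<le> x\<^sup>2" using True assms by (intro power_increasing) auto
    ultimately show ?thesis by (intro mult_mono) auto
  next
    case False
    have "(\<Sum>j\<in>insert 2 (insert 4 {Suc (Suc s)..n}). x ^ j / fact j) \<le> exp x"
      using assms by (intro sum_power_div_fact_le_exp) auto
    then have G: "?G \<le> exp x - x\<^sup>2 / 2 - x ^ 4 / 24"
      using False by (simp add: fact_numeral)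
    have "x ^ s = exp (real s * ln x)"
      using assms(3) by (simp add: exp_of_nat_mult)
    also have "real s * ln x \<le> x ^ 3 * (x / 24)"
      using assms by (intro mult_mono) auto
    also have "\<dots> = x ^ 4 / 24" by (simp add: eval_nat_numeral)
    finally have "x ^ s \<le> exp (x ^ 4 / 24)" by simp
    then have "x ^ s * exp ?G \<le> exp (x ^ 4 / 24) * exp (exp x - x\<^sup>2 / 2 - x ^ 4 / 24)"
      using G by (intro mult_mono) auto
    also have "\<dots> = 1 * exp (exp x - x\<^sup>2 / 2)"
      by (simp add: exp_add[symmetric])
    also have "\<dots> \<le> x\<^sup>2 * exp (exp x - x\<^sup>2 / 2)"
      using assms(3) by (intro mult_right_mono) auto
    finally show ?thesis .
  qed
  have "egf_coeff (Suc s) (n - s) * x ^ n = x ^ s * (egf_coeff (Suc s) (n - s) * x ^ (n - s))"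
    using assms(2) by (simp add: power_add[symmetric])
  also have "\<dots> \<le> x ^ s * exp ?G"
    using assms(3) by (intro mult_left_mono egf_coeff_power_le) auto
  finally show ?thesis using main by simp
qed

text \<open>Writing \<open>y ^ j / fact j = (4 * y) ^ j / fact j / 4 ^ j\<close> bounds the exponential tail from
  \<open>j = 4 * y\<close> on by \<open>exp (4 * y) / 4 ^ (4 * y) \<le> 1\<close>.\<close>

lemma egf_coeff_le_large_gap:
  fixes y :: real
  assumes "2 * s \<le> n" "1 \<le> y" "4 * y \<le> real s"
  shows "egf_coeff (Suc s) (n - s) * y powr (real n / 2) \<le> exp 1"
proof -
  have "(\<Sum>j=Suc (Suc s)..n. y ^ j / fact j) \<le> (\<Sum>j=Suc (Suc s)..n. exp (- real s) * ((4 * y) ^ j / fact j))"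
  proof (rule sum_mono)
    fix j assume j: "j \<in> {Suc (Suc s)..n}"
    have "exp (real s) = exp 1 ^ s" by (simp add: exp_of_nat_mult[symmetric])
    also have "\<dots> \<le> 4 ^ s" using exp_le by (intro power_mono) auto
    also have "\<dots> \<le> 4 ^ j" using j by (intro power_increasing) auto
    finally have "exp (real s) * (y ^ j / fact j) \<le> 4 ^ j * (y ^ j / fact j)"
      using assms by (intro mult_right_mono) auto
    then show "y ^ j / fact j \<le> exp (- real s) * ((4 * y) ^ j / fact j)"
      by (simp add: exp_minus power_mult_distrib field_simps)
  qed
  also have "\<dots> = exp (- real s) * (\<Sum>j=Suc (Suc s)..n. (4 * y) ^ j / fact j)"
    by (simp add: sum_distrib_left)
  also have "\<dots> \<le> exp (- real s) * exp (4 * y)"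
    using assms by (intro mult_left_mono sum_power_div_fact_le_exp) auto
  also have "\<dots> \<le> 1"
    using assms by (simp add: exp_add[symmetric])
  finally have tail: "(\<Sum>j=Suc (Suc s)..n. y ^ j / fact j) \<le> 1" .
  \<comment> \<open>The gap condition leaves at least half of the elements above the gap, which
    makes the exponent independent of \<open>s\<close>.\<close>
  have "y powr (real n / 2) \<le> y powr real (n - s)"
    using assms by (intro powr_mono) (auto simp: of_nat_diff)
  also have "\<dots> = y ^ (n - s)" using assms by (intro powr_realpow) simp
  finally have "egf_coeff (Suc s) (n - s) * y powr (real n / 2) \<le> egf_coeff (Suc s) (n - s) * y ^ (n - s)"
    by (intro mult_left_mono egf_coeff_nonneg)
  also have "\<dots> \<le> exp (\<Sum>j=Suc (Suc s)..n. y ^ j / fact j)"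
    using assms by (intro egf_coeff_power_le) auto
  also have "\<dots> \<le> exp 1" using tail by simp
  finally show ?thesis .
qed

text \<open>The hypothesis says \<open>k ^ k \<le> exp n\<close>, so the factor \<open>k ^ k\<close>
  from \<open>k!\<close> is cancelled by the \<open>exp (- n)\<close> from
  \<open>n!\<close>.\<close>

lemma fact_mult_fact_le:
  assumes "1 \<le> k" "1 \<le> n" "real k * ln (real k) \<le> real n"
  shows "fact n * fact k \<le> exp 2 * real n * real k * real n ^ n * exp (- real k)"
proof -
  have kk: "real k ^ k \<le> exp (real n)"
  proof -
    have "real k ^ k = exp (real k * ln (real k))"
      using assms by (simp add: exp_of_nat_mult)
    then show ?thesis using assms by simp
  qed
  have "fact n * fact k \<le> (real n ^ Suc n * exp (1 - real n)) * (real k ^ Suc k * exp (1 - real k))"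
    using assms by (intro mult_mono fact_le_power_exp) auto
  also have "\<dots> = exp 2 * real n * real k * real n ^ n * exp (- real k) * exp (- real n) * real k ^ k"
    by (simp add: exp_diff exp_minus field_simps exp_add[symmetric])
  also have "\<dots> \<le> exp 2 * real n * real k * real n ^ n * exp (- real k) * exp (- real n) * exp (real n)"
    using kk by (intro mult_left_mono) auto
  also have "\<dots> = exp 2 * real n * real k * real n ^ n * exp (- real k)"
    by (simp add: mult.assoc exp_add[symmetric])
  finally show ?thesis .
qed

section \<open>Comparison of both bounds at a fixed saddle point\<close>

context
  fixes k n :: nat and x :: real
  defines "x \<equiv> ln (real k)"
  assumes k: "1 \<le> k" and n: "2 \<le> n"
    and lower: "real k * x \<le> real n"
    and upper: "real n \<le> (real k + 1) * ln (real k + 1)"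
    and upper': "real n \<le> 2 * real k * x"
    and x_large: "16 * exp 1 \<le> x"
    and ln_x: "ln x \<le> x / 24"
begin

lemma saddle_ge_1: "1 \<le> x"
  using x_large exp_ge_add_one_self[of 1] by linarith

lemma exp_saddle: "exp x = real k"
  using k by (simp add: x_def)

text \<open>Replacing \<open>n\<close> by \<open>k * x\<close> in \<open>n ^ n\<close> costs only a
  polynomial factor: \<open>n\<close> exceeds \<open>k * x\<close> by at most
  \<open>ln (k + 1) + 1\<close>, and \<open>(1 + u) ^ n \<le> exp (n * u)\<close>.\<close>

lemma ratio_power_le: "real n ^ n \<le> exp 2 * (real k + 1)\<^sup>2 * (real k * x) ^ n"
proof -
  have pos: "real k * x > 0" using k saddle_ge_1 by simp
  \<comment> \<open>The difference \<open>(k + 1) ln (k + 1) - k ln k\<close> equals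
    \<open>ln (k + 1)\<close> plus this quantity.\<close>
  have "real k * (ln (real k + 1) - ln (real k)) = real k * ln (1 + 1 / real k)"
    using k ln_div[of "real k + 1" "real k"] by (simp add: add_divide_distrib)
  also have "\<dots> \<le> real k * (1 / real k)"
    by (intro mult_left_mono ln_add_one_self_le_self) auto
  also have "\<dots> = 1" using k by simp
  finally have d: "real n - real k * x \<le> ln (real k + 1) + 1"
    using upper by (simp add: x_def algebra_simps)
  have "real n / (real k * x) = 1 + (real n - real k * x) / (real k * x)"
    using k saddle_ge_1 by (simp add: diff_divide_distrib)
  also have "\<dots> \<le> exp ((real n - real k * x) / (real k * x))"
    by (rule exp_ge_add_one_self)
  finally have "(real n / (real k * x)) ^ n \<le> exp ((real n - real k * x) / (real k * x)) ^ n"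
    using pos by (intro power_mono) auto
  also have "\<dots> = exp (real n / (real k * x) * (real n - real k * x))"
    by (simp add: exp_of_nat_mult[symmetric])
  also have "\<dots> \<le> exp (2 * (ln (real k + 1) + 1))"
  proof -
    have "real n / (real k * x) \<le> 2" using upper' pos by (simp add: divide_le_eq mult.assoc)
    then have "real n / (real k * x) * (real n - real k * x) \<le> 2 * (ln (real k + 1) + 1)"
      using d lower pos by (intro mult_mono) auto
    then show ?thesis by simp
  qed
  also have "\<dots> = exp 2 * (real k + 1)\<^sup>2"
    using exp_of_nat_mult[of 2 "ln (real k + 1)"] by (simp add: distrib_left exp_add)
  finally show ?thesis using pos by (simp add: power_divide divide_le_eq)
qed

text \<open>The factor \<open>fact k\<close> prepares the comparison with the lower bound
  \<open>k ^ (n - 2) / k!\<close>. Since \<open>exp x = k\<close>, the main term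
  \<open>exp (exp x)\<close> cancels \<open>exp (- k)\<close>, and only
  \<open>exp (- (x\<^sup>2 / 2))\<close> and polynomial factors remain beside
  \<open>k ^ n\<close>.\<close>

lemma small_gap_term_le:
  assumes "1 \<le> s" "2 * s \<le> n" "real s \<le> x ^ 3"
  shows "fact n * egf_coeff (Suc s) (n - s) * fact k
    \<le> exp 4 * real n * real k * (real k + 1)\<^sup>2 * x\<^sup>2 * exp (- (x\<^sup>2 / 2)) * real k ^ n"
proof -
  let ?c = "egf_coeff (Suc s) (n - s)"
  have "fact n * ?c * fact k = ?c * (fact n * fact k)" by simp
  also have "\<dots> \<le> ?c * (exp 2 * real n * real k * real n ^ n * exp (- real k))"
    using fact_mult_fact_le[of k n] k n lower
    by (intro mult_left_mono egf_coeff_nonneg) (auto simp: x_def)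
  also have "\<dots> \<le> ?c * (exp 2 * real n * real k * (exp 2 * (real k + 1)\<^sup>2 * (real k * x) ^ n) * exp (- real k))"
    by (intro mult_left_mono mult_right_mono ratio_power_le egf_coeff_nonneg) auto
  also have "\<dots> = (?c * x ^ n) * (exp 4 * real n * real k * (real k + 1)\<^sup>2 * exp (- real k) * real k ^ n)"
    using exp_add[of 2 "2::real"] by (simp add: power_mult_distrib)
  also have "\<dots> \<le> (x\<^sup>2 * exp (exp x - x\<^sup>2 / 2)) *
      (exp 4 * real n * real k * (real k + 1)\<^sup>2 * exp (- real k) * real k ^ n)"
    using assms saddle_ge_1 ln_x by (intro mult_right_mono egf_coeff_le_small_gap) auto
  also have "\<dots> = exp 4 * real n * real k * (real k + 1)\<^sup>2 * x\<^sup>2 * exp (- (x\<^sup>2 / 2)) * real k ^ n"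
    using exp_add[of "real k - x\<^sup>2 / 2" "- real k"] by (simp add: exp_saddle)
  finally show ?thesis .
qed

text \<open>Here \<open>n \<le> 2 * k * x\<close> suffices: \<open>(2 * x) ^ n\<close> is the power
  \<open>n / 2\<close> of \<open>4 * x\<^sup>2\<close>, while the coefficient is bounded by
  \<open>exp 1\<close> over the power \<open>n / 2\<close> of the much larger
  \<open>x ^ 3 / 4\<close>.\<close>

lemma large_gap_term_le:
  assumes "2 * s \<le> n" "x ^ 3 \<le> real s"
  shows "fact n * egf_coeff (Suc s) (n - s) * fact k
    \<le> exp 3 * real n * real k * exp (- (real n / 2)) * real k ^ n"
proof -
  let ?c = "egf_coeff (Suc s) (n - s)"
  \<comment> \<open>Chosen so that the requirement \<open>4 * ?y \<le> real s\<close> is exactly the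
    case assumption on \<open>s\<close>.\<close>
  let ?y = "x ^ 3 / 4"
  have x16: "x \<ge> 16" using x_large exp_ge_add_one_self[of 1] by linarith
  have "1 \<le> ?y" using power_mono[of 16 x 3] x16 by simp
  have "real n ^ n \<le> (2 * real k * x) ^ n"
    using upper' by (intro power_mono) auto
  also have "\<dots> = real k ^ n * (2 * x) ^ n"
    by (simp add: power_mult_distrib)
  also have "(2 * x) ^ n = (4 * x\<^sup>2) powr (real n / 2)"
  proof -
    have "(2 * x) ^ n = ((2 * x) powr 2) powr (real n / 2)"
      unfolding powr_powr using saddle_ge_1 powr_realpow[of "2 * x" n] by simp
    also have "(2 * x) powr 2 = 4 * x\<^sup>2"
      using saddle_ge_1 by (simp add: powr_numeral power_mult_distrib)
    finally show ?thesis .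
  qed
  also have "(4 * x\<^sup>2) powr (real n / 2) \<le> (?y * exp (- 1)) powr (real n / 2)"
  proof (rule powr_mono2)
    \<comment> \<open>The constant \<open>16 * exp 1\<close> in \<open>x_large\<close> leaves a
      spare factor \<open>exp (- 1)\<close>, whose power \<open>n / 2\<close> is the exponential
      gain.\<close>
    have "16 * exp 1 * x\<^sup>2 \<le> x * x\<^sup>2" using x_large by (intro mult_right_mono) auto
    then show "4 * x\<^sup>2 \<le> ?y * exp (- 1)"
      by (simp add: exp_minus field_simps power2_eq_square power3_eq_cube)
  qed auto
  also have "\<dots> = ?y powr (real n / 2) * exp (- (real n / 2))"
    using saddle_ge_1 by (subst powr_mult) (auto simp: powr_def)
  finally have nn: "real n ^ n \<le> real k ^ n * (?y powr (real n / 2) * exp (- (real n / 2)))"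
    using k by (simp add: mult_left_mono)
  have "fact n * ?c * fact k = ?c * (fact n * fact k)" by simp
  also have "\<dots> \<le> ?c * (exp 2 * real n * real k * real n ^ n * exp (- real k))"
    using fact_mult_fact_le[of k n] k n lower
    by (intro mult_left_mono egf_coeff_nonneg) (auto simp: x_def)
  also have "\<dots> \<le> ?c * (exp 2 * real n * real k *
      (real k ^ n * (?y powr (real n / 2) * exp (- (real n / 2)))) * 1)"
    by (intro mult_left_mono mult_mono nn egf_coeff_nonneg mult_nonneg_nonneg) auto
  also have "\<dots> = (?c * ?y powr (real n / 2)) * (exp 2 * real n * real k * exp (- (real n / 2)) * real k ^ n)"
    by (simp add: mult_ac)
  also have "\<dots> \<le> exp 1 * (exp 2 * real n * real k * exp (- (real n / 2)) * real k ^ n)"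
    using assms \<open>1 \<le> ?y\<close> by (intro mult_right_mono egf_coeff_le_large_gap) auto
  also have "\<dots> = exp 3 * real n * real k * exp (- (real n / 2)) * real k ^ n"
    using exp_add[of 1 "2::real"] by simp
  finally show ?thesis .
qed


lemma power_le_fact_mult_singleton_free:
  "real k ^ (n - 2) \<le> fact k * real (card (large_block_partitions 1 {1..n}))"
proof -
  have eq: "{1..n} = insert n (insert (n - 1) {1..n - 2})" using n by auto
  have "card (large_block_partitions 0 {1..n - 2}) \<le> card (large_block_partitions 1 {1..n})"
    unfolding eq by (rule card_partitions_le_card_singleton_free) (use n in auto)
  then have "fact k * card (large_block_partitions 0 {1..n - 2}) \<le> fact k * card (large_block_partitions 1 {1..n})"
    by (rule mult_le_mono2)
  moreover have "k ^ (n - 2) \<le> fact k * card (large_block_partitions 0 {1..n - 2})"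
    using power_le_fact_mult_card_partitions[of "{1..n - 2}" k] by simp
  ultimately have "k ^ (n - 2) \<le> fact k * card (large_block_partitions 1 {1..n})"
    by (rule order_trans[rotated])
  then have "real (k ^ (n - 2)) \<le> real (fact k * card (large_block_partitions 1 {1..n}))"
    by (rule of_nat_mono)
  then show ?thesis by simp
qed

lemma card_impractical_with_singleton_le_singleton_free:
  "real (card {P. partition_on {1..n} P \<and> \<not> practical_partition {1..n} P \<and> (\<exists>b\<in>P. card b = 1)})
    \<le> real (card (large_block_partitions 1 {1..n})) *
      (exp 4 * real n ^ 2 * real k ^ 3 * (real k + 1)\<^sup>2 * x\<^sup>2 * exp (- (x\<^sup>2 / 2))
       + exp 3 * real n ^ 2 * real k ^ 3 * exp (- (real n / 2)))"
  (is "real ?T \<le> real ?B * ?R")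
proof -
  let ?I = "{s. 1 \<le> s \<and> 2 * s + 2 \<le> n}"
  \<comment> \<open>The sum of the small-gap and the large-gap bound dominates every term. The at
    most \<open>n\<close> values of \<open>s\<close> and
    \<open>k ^ n = k\<^sup>2 * k ^ (n - 2)\<close> account for the extra factors of the
    claim.\<close>
  define D where "D = exp 4 * real n * real k * (real k + 1)\<^sup>2 * x\<^sup>2 * exp (- (x\<^sup>2 / 2))
    + exp 3 * real n * real k * exp (- (real n / 2))"
  have D: "D \<ge> 0" unfolding D_def by (intro add_nonneg_nonneg mult_nonneg_nonneg) auto
  have "?I \<subseteq> {1..n}" by auto
  then have cardI: "card ?I \<le> n" using card_mono[of "{1..n}" ?I] by simp
  have "fact k * real ?T \<le> fact k * (\<Sum>s\<in>?I. fact n * egf_coeff (Suc s) (n - s))"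
    using card_impractical_with_singleton_le[of "{1..n}"] by (intro mult_left_mono) auto
  also have "\<dots> = (\<Sum>s\<in>?I. fact n * egf_coeff (Suc s) (n - s) * fact k)"
    by (simp add: sum_distrib_left mult_ac)
  also have "\<dots> \<le> (\<Sum>s\<in>?I. D * real k ^ n)"
  proof (rule sum_mono)
    fix s assume s: "s \<in> ?I"
    show "fact n * egf_coeff (Suc s) (n - s) * fact k \<le> D * real k ^ n"
    proof (cases "real s \<le> x ^ 3")
      case True
      have "exp 3 * real n * real k * exp (- (real n / 2)) * real k ^ n \<ge> 0" by simp
      then show ?thesis
        using small_gap_term_le[of s] s True unfolding D_def distrib_right mem_Collect_eq by linarith
    next
      case False
      have "exp 4 * real n * real k * (real k + 1)\<^sup>2 * x\<^sup>2 * exp (- (x\<^sup>2 / 2)) * real k ^ n \<ge> 0"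
        by simp
      then show ?thesis
        using large_gap_term_le[of s] s False unfolding D_def distrib_right mem_Collect_eq by linarith
    qed
  qed
  also have "\<dots> \<le> real n * (D * real k ^ n)"
    using cardI D by (simp add: mult_right_mono)
  also have "real k ^ n = (real k)\<^sup>2 * real k ^ (n - 2)"
    using n by (metis le_add_diff_inverse power_add)
  also have "real n * (D * ((real k)\<^sup>2 * real k ^ (n - 2))) \<le>
      real n * (D * ((real k)\<^sup>2 * (fact k * real ?B)))"
    using D by (intro mult_left_mono power_le_fact_mult_singleton_free) auto
  also have "\<dots> = fact k * (real ?B * ?R)"
    unfolding D_def by (simp add: algebra_simps power2_eq_square power3_eq_cube)
  finally show ?thesis by simp
qed

end

section \<open>From the counting bounds to the asymptotic formula\<close>

text \<open>A partition without singletons is impractical for \<open>n \<ge> 1\<close>, because a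
  sum of block sizes can equal 1 only if some block has size 1.\<close>

lemma impractical_number_eq:
  assumes "n \<ge> 1"
  shows "impractical_number n = singleton_free_number n +
    card {P. partition_on {1..n} P \<and> \<not> practical_partition {1..n} P \<and> (\<exists>b\<in>P. card b = 1)}"
proof -
  let ?F = "{P. partition_on {1..n} P \<and> (\<forall>b\<in>P. card b \<noteq> 1)}"
  let ?T = "{P. partition_on {1..n} P \<and> \<not> practical_partition {1..n} P \<and> (\<exists>b\<in>P. card b = 1)}"
  have "\<not> practical_partition {1..n} P" if P: "P \<in> ?F" for P
  proof
    assume "practical_partition {1..n} P"
    then have "1 \<in> {\<Sum>b\<in>S. card b | S. S \<subseteq> P}"
      using assms unfolding practical_partition_def by auto
    then obtain S where S: "S \<subseteq> P" "(\<Sum>b\<in>S. card b) = 1" by auto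
    then have "finite S" by (metis sum.infinite zero_neq_one)
    then obtain b where "b \<in> S" "card b = 1"
      using S(2) sum_eq_1_iff[of S card] by blast
    then show False using P S by auto
  qed
  then have "{P. partition_on {1..n} P \<and> \<not> practical_partition {1..n} P} = ?F \<union> ?T" by blast
  moreover have "finite ?F" "finite ?T"
    by (rule finite_subset[OF _ finitely_many_partition_on[of "{1..n}"]]; auto)+
  moreover have "?F \<inter> ?T = {}" by auto
  ultimately show ?thesis
    unfolding impractical_number_eq_card singleton_free_number_def by (simp add: card_Un_disjoint)
qed

lemma singleton_free_number_eq:
  "singleton_free_number n = card (large_block_partitions 1 {1..n})"
proof -
  have "{P. partition_on {1..n} P \<and> (\<forall>b\<in>P. card b \<noteq> 1)} =
      {P \<in> large_block_partitions 0 {1..n}. \<forall>b\<in>P. card b \<noteq> 1}"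
    using large_block_partitions_0[of "{1..n}"] by auto
  also have "\<dots> = large_block_partitions 1 {1..n}"
    unfolding large_block_partitions_def by force
  finally show ?thesis unfolding singleton_free_number_def by simp
qed

text \<open>Take the least \<open>k\<close> with \<open>n \<le> (k + 1) ln (k + 1)\<close>.
  Minimality at the predecessor of \<open>k\<close> gives \<open>k ln k \<le> n\<close>, and
  monotonicity makes \<open>k\<close> tend to infinity with \<open>n\<close>.\<close>

lemma saddle_point_exists:
  obtains k :: "nat \<Rightarrow> nat" where "filterlim k at_top sequentially"
    "\<And>n. real (k n) * ln (real (k n)) \<le> real n"
    "\<And>n. real n \<le> (real (k n) + 1) * ln (real (k n) + 1)"
proof -
  define g where "g = (\<lambda>k::nat. (real k + 1) * ln (real k + 1))"
  define k where "k = (\<lambda>n::nat. LEAST k. real n \<le> g k)"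
  have g_mono: "g i \<le> g j" if "i \<le> j" for i j
    unfolding g_def using that by (intro mult_mono) auto
  have "filterlim g at_top sequentially"
    unfolding g_def by real_asymp
  then have ex: "\<exists>k. real n \<le> g k" for n :: nat
    unfolding filterlim_at_top by (meson eventually_happens sequentially_bot)
  have upper: "real n \<le> g (k n)" for n
    unfolding k_def using LeastI_ex[OF ex] .
  have lower: "real (k n) * ln (real (k n)) \<le> real n" for n
  proof (cases "k n")
    case (Suc j)
    then have "\<not> real n \<le> g j" using not_less_Least[of j "\<lambda>k. real n \<le> g k"] by (simp add: k_def)
    then show ?thesis using Suc by (simp add: g_def add.commute)
  qed simp
  have "filterlim k at_top sequentially"
    unfolding filterlim_at_top
  proof
    fix K
    have "eventually (\<lambda>n. g K < real n) sequentially" by real_asymp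
    then show "eventually (\<lambda>n. K \<le> k n) sequentially"
    proof eventually_elim
      case (elim n)
      then have "\<not> k n \<le> K" using upper[of n] g_mono[of "k n" K] by linarith
      then show ?case by simp
    qed
  qed
  then show thesis using that lower upper unfolding g_def by blast
qed

theorem theorem2:
  shows "\<exists>E :: nat \<Rightarrow> real.
           E \<in> O(\<lambda>n. exp (- ((ln (real n))\<^sup>2 / 3))) \<and>
           (\<forall>\<^sub>F n in sequentially.
              real (impractical_number n) = real (singleton_free_number n) * (1 + E n))"
proof -
  obtain k :: "nat \<Rightarrow> nat" where k: "filterlim k at_top sequentially"
    "\<And>n. real (k n) * ln (real (k n)) \<le> real n"
    "\<And>n. real n \<le> (real (k n) + 1) * ln (real (k n) + 1)"
    by (rule saddle_point_exists) blast
  define T where "T = (\<lambda>n::nat. card {P. partition_on {1..n} P \<and> \<not> practical_partition {1..n} P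
    \<and> (\<exists>b\<in>P. card b = 1)})"
  \<comment> \<open>The exact relative error. It takes the value 0 where the denominator vanishes,
    so the identity is claimed only once singleton-free partitions exist.\<close>
  define E where "E = (\<lambda>n. real (T n) / real (singleton_free_number n))"
  define N where "N = (\<lambda>m::nat. (real m + 1) * ln (real m + 1))"
  \<comment> \<open>Everything is expressed in \<open>m = k n\<close>, with \<open>N m\<close>
    bounding \<open>n\<close> from above. As \<open>ln (N m)\<close> is asymptotic to
    \<open>ln m\<close>, weakening the constant 1/2 in the exponent to 1/3 leaves room to absorb all
    polynomial factors.\<close>
  have "\<forall>\<^sub>F m in sequentially. 1 \<le> m \<and> N m \<le> 2 * real m * ln (real m) \<and> 16 * exp 1 \<le> ln (real m)
      \<and> ln (ln (real m)) \<le> ln (real m) / 24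
      \<and> exp 4 * N m ^ 2 * real m ^ 3 * (real m + 1)\<^sup>2 * (ln (real m))\<^sup>2 * exp (- ((ln (real m))\<^sup>2 / 2))
        \<le> exp (- ((ln (N m))\<^sup>2 / 3))"
    unfolding N_def by (intro eventually_conj; real_asymp)
  then have ev_k: "\<forall>\<^sub>F n in sequentially. 1 \<le> k n \<and> N (k n) \<le> 2 * real (k n) * ln (real (k n))
      \<and> 16 * exp 1 \<le> ln (real (k n)) \<and> ln (ln (real (k n))) \<le> ln (real (k n)) / 24
      \<and> exp 4 * N (k n) ^ 2 * real (k n) ^ 3 * (real (k n) + 1)\<^sup>2 * (ln (real (k n)))\<^sup>2
          * exp (- ((ln (real (k n)))\<^sup>2 / 2)) \<le> exp (- ((ln (N (k n)))\<^sup>2 / 3))"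
    using k(1) by (rule eventually_compose_filterlim)
  have ev_n: "\<forall>\<^sub>F n in sequentially. exp 3 * real n ^ 5 * exp (- (real n / 2)) \<le> exp (- ((ln (real n))\<^sup>2 / 3))"
    by real_asymp
  \<comment> \<open>The factor 2 arises because small gaps and large gaps each contribute one copy
    of the error term.\<close>
  have "\<forall>\<^sub>F n in sequentially. singleton_free_number n > 0 \<and> E n \<le> 2 * exp (- ((ln (real n))\<^sup>2 / 3))"
    using ev_k ev_n eventually_ge_at_top[of 2]
  proof eventually_elim
    case (elim n)
    let ?k = "real (k n)" and ?x = "ln (real (k n))" and ?B = "real (card (large_block_partitions 1 {1..n}))"
    have nN: "real n \<le> N (k n)" using k(3) by (simp add: N_def)
    have x1: "1 \<le> ?x" using elim(1) exp_ge_add_one_self[of 1] by linarith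
    have prem: "1 \<le> k n" "2 \<le> n" "?k * ?x \<le> real n" "real n \<le> (?k + 1) * ln (?k + 1)"
        "real n \<le> 2 * ?k * ?x" "16 * exp 1 \<le> ?x" "ln ?x \<le> ?x / 24"
      using elim k(2,3) nN by auto
    have "0 < ?k ^ (n - 2)" using prem(1) by simp
    also have "\<dots> \<le> fact (k n) * ?B" by (rule power_le_fact_mult_singleton_free[OF prem])
    finally have B: "?B > 0" by (simp add: zero_less_mult_iff)
    have "?k * 1 \<le> ?k * ?x" using x1 by (intro mult_left_mono) auto
    then have kn: "?k \<le> real n" using prem(3) by simp
    have "real (T n) \<le> ?B * (exp 4 * real n ^ 2 * ?k ^ 3 * (?k + 1)\<^sup>2 * ?x\<^sup>2 * exp (- (?x\<^sup>2 / 2))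
       + exp 3 * real n ^ 2 * ?k ^ 3 * exp (- (real n / 2)))"
      unfolding T_def by (rule card_impractical_with_singleton_le_singleton_free[OF prem])
    then have "E n \<le> exp 4 * real n ^ 2 * ?k ^ 3 * (?k + 1)\<^sup>2 * ?x\<^sup>2 * exp (- (?x\<^sup>2 / 2))
       + exp 3 * real n ^ 2 * ?k ^ 3 * exp (- (real n / 2))"
      using B unfolding E_def singleton_free_number_eq by (simp add: divide_le_eq mult.commute)
    also have "\<dots> \<le> exp 4 * N (k n) ^ 2 * ?k ^ 3 * (?k + 1)\<^sup>2 * ?x\<^sup>2 * exp (- (?x\<^sup>2 / 2))
       + exp 3 * real n ^ 2 * real n ^ 3 * exp (- (real n / 2))"
      using nN kn by (intro add_mono mult_right_mono mult_left_mono power_mono) auto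
    also have "\<dots> \<le> exp (- ((ln (N (k n)))\<^sup>2 / 3)) + exp (- ((ln (real n))\<^sup>2 / 3))"
      using elim(1,2) by (intro add_mono) (auto simp: mult.assoc simp flip: power_add)
    also have "exp (- ((ln (N (k n)))\<^sup>2 / 3)) \<le> exp (- ((ln (real n))\<^sup>2 / 3))"
      using nN elim(3) by (simp add: power_mono)
    finally show ?case using B by (simp add: singleton_free_number_eq)
  qed
  then have ev: "\<forall>\<^sub>F n in sequentially. singleton_free_number n > 0"
      "\<forall>\<^sub>F n in sequentially. E n \<le> 2 * exp (- ((ln (real n))\<^sup>2 / 3))"
    by (auto elim: eventually_mono)
  have "E \<in> O(\<lambda>n. exp (- ((ln (real n))\<^sup>2 / 3)))"
    using ev(2) by (intro bigoI[of _ 2]) (auto elim!: eventually_mono simp: E_def)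
  moreover have "\<forall>\<^sub>F n in sequentially.
      real (impractical_number n) = real (singleton_free_number n) * (1 + E n)"
    using ev(1) eventually_ge_at_top[of 1]
  proof eventually_elim
    case (elim n)
    then show ?case
      using impractical_number_eq[of n] by (simp add: E_def T_def field_simps)
  qed
  ultimately show ?thesis by blast
qed

end
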